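(* Let $R$ be a commutative integral domain and let $L_R$ be the dual of its lattice of ideals. Then $L_R$ is transversally bounded if and only if $L_R$ is uniformly transversally bounded.
   Context: Let $L$ be a complete lattice with largest element $1$ which is finitely join-irreducible, meaning that $1$ is not the join of two strictly smaller elements. For a family $(X_i)_{i\in I}$ of nonempty subsets of $L$, a transversal of $(X_i)_{i\in I}$ is an element $(x_i)_{i\in I}\in\prod_{i\in I}X_i$; it is bounded if $\bigvee\{x_i: i\in I\}<1$. $L$ is called transversally bounded if for each family $(X_i)_{i\in I}$ of nonempty subsets of $L$ all of whose transversals are bounded, $\bigvee X_i<1$ for all but finitely many $i\in I$. $L$ is called uniformly transversally bounded if for each family $(X_i)_{i\in I}$ of nonempty subsets of $L$ all of whose transversals are bounded, there is a cofinite subset $J\subseteq I$ (i.e. $I\setminus J$ is finite) such that $\bigvee\big(\bigcup_{i\in J}X_i\big)<1$. For a commutative integral domain $R$, $L_R$ denotes the lattice of ideals of $R$ ordered by reverse inclusion; thus joins in $L_R$ are intersections of ideals, the largest element $1$ of $L_R$ is the zero ideal, and $L_R$ is complete and finitely join-irreducible. *)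

theory Defs
  imports "HOL-Algebra.Complete_Lattice" "HOL-Algebra.Ideal" "HOL-Library.FuncSet"
begin

section \<open>Finitely join-irreducible top element\<close>

definition top_join_irreducible :: "('a, 'b) gorder_scheme \<Rightarrow> bool" where
  "top_join_irreducible L \<longleftrightarrow>
     (\<forall>x\<in>carrier L. \<forall>y\<in>carrier L.
        x \<sqsubset>\<^bsub>L\<^esub> \<top>\<^bsub>L\<^esub> \<longrightarrow> y \<sqsubset>\<^bsub>L\<^esub> \<top>\<^bsub>L\<^esub> \<longrightarrow> x \<squnion>\<^bsub>L\<^esub> y \<noteq> \<top>\<^bsub>L\<^esub>)"


section \<open>Transversals\<close>

definition nonempty_subset_family ::
    "('a, 'b) gorder_scheme \<Rightarrow> 'i set \<Rightarrow> ('i \<Rightarrow> 'a set) \<Rightarrow> bool" where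
  "nonempty_subset_family L I X \<longleftrightarrow> (\<forall>i\<in>I. X i \<subseteq> carrier L \<and> X i \<noteq> {})"

definition transversals :: "'i set \<Rightarrow> ('i \<Rightarrow> 'a set) \<Rightarrow> ('i \<Rightarrow> 'a) set" where
  "transversals I X = (\<Pi>\<^sub>E i\<in>I. X i)"

definition bounded_transversal ::
    "('a, 'b) gorder_scheme \<Rightarrow> 'i set \<Rightarrow> ('i \<Rightarrow> 'a) \<Rightarrow> bool" where
  "bounded_transversal L I x \<longleftrightarrow> \<Squnion>\<^bsub>L\<^esub>(x ` I) \<sqsubset>\<^bsub>L\<^esub> \<top>\<^bsub>L\<^esub>"

text \<open>
  A definition cannot quantify over the type of the indices. Indices are therefore taken from
  \<^typ>\<open>'a set \<times> nat\<close>, with \<open>'a\<close> the type of the lattice elements. This is no restriction: the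
  lemmas \<open>transversally_bounded_any_index\<close> and \<open>uniformly_transversally_bounded_any_index\<close> below
  give the two properties for families indexed by sets of any type.
\<close>

definition transversally_bounded :: "('a, 'b) gorder_scheme \<Rightarrow> bool" where
  "transversally_bounded L \<longleftrightarrow>
     (\<forall>(I :: ('a set \<times> nat) set) X.
        nonempty_subset_family L I X \<longrightarrow>
        (\<forall>x\<in>transversals I X. bounded_transversal L I x) \<longrightarrow>
        finite {i \<in> I. \<not> \<Squnion>\<^bsub>L\<^esub>(X i) \<sqsubset>\<^bsub>L\<^esub> \<top>\<^bsub>L\<^esub>})"

definition uniformly_transversally_bounded :: "('a, 'b) gorder_scheme \<Rightarrow> bool" where
  "uniformly_transversally_bounded L \<longleftrightarrow>
     (\<forall>(I :: ('a set \<times> nat) set) X.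
        nonempty_subset_family L I X \<longrightarrow>
        (\<forall>x\<in>transversals I X. bounded_transversal L I x) \<longrightarrow>
        (\<exists>J\<subseteq>I. finite (I - J) \<and> \<Squnion>\<^bsub>L\<^esub>(\<Union>i\<in>J. X i) \<sqsubset>\<^bsub>L\<^esub> \<top>\<^bsub>L\<^esub>))"


section \<open>Independence of the index type\<close>

lemma (in complete_lattice) sup_less_top_mono:
  assumes "A \<subseteq> B" "B \<subseteq> carrier L" "\<Squnion>B \<sqsubset> \<top>"
  shows "\<Squnion>A \<sqsubset> \<top>"
proof -
  have A: "A \<subseteq> carrier L" using assms by blast
  have le: "\<Squnion>A \<sqsubseteq> \<Squnion>B"
  proof (rule sup_least)
    show "\<And>x. x \<in> A \<Longrightarrow> x \<sqsubseteq> \<Squnion>B" using assms by (meson sup_upper subsetD)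
  qed (use A assms in auto)
  have c: "\<Squnion>A \<in> carrier L" "\<Squnion>B \<in> carrier L" using A assms by auto
  show ?thesis
    using le c assms(3) top_higher top_closed le_antisym unfolding lless_def
    by (metis eq_is_equal)
qed

lemma family_reindex:
  fixes I :: "'i set" and X :: "'i \<Rightarrow> 'a set"
  defines "fib \<equiv> (\<lambda>A. {i \<in> I. X i = A})"
  defines "K \<equiv> {(A, n). A \<in> X ` I \<and> (finite (fib A) \<longrightarrow> n < card (fib A))}"
  obtains g :: "'a set \<times> nat \<Rightarrow> 'i"
  where "inj_on g K" "\<And>k. k \<in> K \<Longrightarrow> g k \<in> I" "\<And>k. k \<in> K \<Longrightarrow> X (g k) = fst k"
proof -
  have "\<exists>h :: nat \<Rightarrow> 'i. inj_on h {n. finite (fib A) \<longrightarrow> n < card (fib A)} \<and>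
      h ` {n. finite (fib A) \<longrightarrow> n < card (fib A)} \<subseteq> fib A" for A
  proof (cases "finite (fib A)")
    case True
    then obtain h where "bij_betw h {0..<card (fib A)} (fib A)"
      using ex_bij_betw_nat_finite by blast
    then show ?thesis using True
      by (intro exI[of _ h]) (auto simp: bij_betw_def inj_on_def)
  next
    case False
    then obtain h :: "nat \<Rightarrow> 'i" where "inj h" "range h \<subseteq> fib A"
      using infinite_countable_subset by blast
    then show ?thesis using False by (intro exI[of _ h]) auto
  qed
  then obtain h :: "'a set \<Rightarrow> nat \<Rightarrow> 'i" where
    h: "\<And>A. inj_on (h A) {n. finite (fib A) \<longrightarrow> n < card (fib A)}"
       "\<And>A. h A ` {n. finite (fib A) \<longrightarrow> n < card (fib A)} \<subseteq> fib A"
    by metis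
  define g where "g = (\<lambda>(A, n). h A n)"
  have m: "g k \<in> fib (fst k)" if "k \<in> K" for k
    using that h(2)[of "fst k"] unfolding K_def g_def by auto
  show ?thesis
  proof (rule that)
    show "inj_on g K"
    proof (rule inj_onI)
      fix k l assume k: "k \<in> K" and l: "l \<in> K" and e: "g k = g l"
      have "fst k = fst l" using m[OF k] m[OF l] e unfolding fib_def by auto
      then show "k = l" using k l e h(1)[of "fst k"]
        unfolding K_def g_def by (auto simp: inj_on_def)
    qed
  qed (use m in \<open>auto simp: fib_def\<close>)
qed

lemma (in complete_lattice) transversals_reindex:
  fixes I :: "'i set" and X :: "'i \<Rightarrow> 'a set"
  assumes ne: "nonempty_subset_family L I X"
    and bd: "\<And>x. x \<in> transversals I X \<Longrightarrow> bounded_transversal L I x"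
    and g: "inj_on g K" "\<And>k. k \<in> K \<Longrightarrow> g k \<in> I" "\<And>k. k \<in> K \<Longrightarrow> X (g k) = Y k"
  shows "nonempty_subset_family L K Y" "\<forall>y\<in>transversals K Y. bounded_transversal L K y"
proof -
  show "nonempty_subset_family L K Y"
    using ne g unfolding nonempty_subset_family_def by metis
  show "\<forall>y\<in>transversals K Y. bounded_transversal L K y"
  proof
    fix y assume y: "y \<in> transversals K Y"
    define x where "x = (\<lambda>i\<in>I. if i \<in> g ` K then y (inv_into K g i) else (SOME a. a \<in> X i))"
    have x: "x i \<in> X i" if i: "i \<in> I" for i
    proof (cases "i \<in> g ` K")
      case True
      then obtain k where k: "k \<in> K" "i = g k" by blast
      then show ?thesis using y i g unfolding x_def transversals_def by auto
    next
      case False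
      then show ?thesis using ne i unfolding x_def nonempty_subset_family_def
        by (auto simp: some_in_eq)
    qed
    then have "x \<in> transversals I X" unfolding transversals_def x_def by (auto simp: PiE_iff)
    then have b: "\<Squnion>(x ` I) \<sqsubset> \<top>" using bd unfolding bounded_transversal_def by blast
    have "x (g k) = y k" if "k \<in> K" for k using that g unfolding x_def by auto
    then have "y ` K \<subseteq> x ` I" using g(2) by (metis image_subset_iff imageI)
    moreover have "x ` I \<subseteq> carrier L" using x ne unfolding nonempty_subset_family_def by blast
    ultimately show "bounded_transversal L K y"
      using b sup_less_top_mono unfolding bounded_transversal_def by blast
  qed
qed

theorem transversally_bounded_any_index:
  fixes I :: "'i set" and X :: "'i \<Rightarrow> 'a set"
  assumes L: "complete_lattice L" and tb: "transversally_bounded L"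
    and ne: "nonempty_subset_family L I X"
    and bd: "\<And>x. x \<in> transversals I X \<Longrightarrow> bounded_transversal L I x"
  shows "finite {i \<in> I. \<not> \<Squnion>\<^bsub>L\<^esub>(X i) \<sqsubset>\<^bsub>L\<^esub> \<top>\<^bsub>L\<^esub>}"
proof -
  interpret complete_lattice L by (rule L)
  let ?fib = "\<lambda>A. {i \<in> I. X i = A}"
  let ?K = "{(A, n :: nat). A \<in> X ` I \<and> (finite (?fib A) \<longrightarrow> n < card (?fib A))}"
  let ?P = "\<lambda>A. \<not> \<Squnion>\<^bsub>L\<^esub>A \<sqsubset>\<^bsub>L\<^esub> \<top>\<^bsub>L\<^esub>"
  obtain g where g: "inj_on g ?K" "\<And>k. k \<in> ?K \<Longrightarrow> g k \<in> I" "\<And>k. k \<in> ?K \<Longrightarrow> X (g k) = fst k"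
    using family_reindex by blast
  have fin: "finite {k \<in> ?K. ?P (fst k)}"
    using tb transversals_reindex[OF ne bd g] unfolding transversally_bounded_def by blast
  have zero: "(X i, 0) \<in> ?K" if "i \<in> I" for i
    using that by (auto simp: card_gt_0_iff)
  have fibfin: "finite (?fib (X i))" if i: "i \<in> I" "?P (X i)" for i
  proof (rule ccontr)
    assume "\<not> ?thesis"
    then have "range (Pair (X i)) \<subseteq> {k \<in> ?K. ?P (fst k)}" using i by auto
    then have "finite (range (Pair (X i) :: nat \<Rightarrow> _))" using fin finite_subset by blast
    then show False by (simp add: finite_image_iff inj_on_def)
  qed
  let ?V = "X ` {i \<in> I. ?P (X i)}"
  have "?V \<subseteq> fst ` {k \<in> ?K. ?P (fst k)}"
  proof
    fix A assume "A \<in> ?V"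
    then obtain i where "i \<in> I" "?P (X i)" "A = X i" by blast
    then show "A \<in> fst ` {k \<in> ?K. ?P (fst k)}"
      using zero[of i] by (intro image_eqI[of _ _ "(X i, 0)"]) auto
  qed
  then have "finite ?V" using fin finite_subset by blast
  then have "finite (\<Union>A\<in>?V. ?fib A)" using fibfin by blast
  then show ?thesis by (rule rev_finite_subset) auto
qed

theorem uniformly_transversally_bounded_any_index:
  fixes I :: "'i set" and X :: "'i \<Rightarrow> 'a set"
  assumes L: "complete_lattice L" and utb: "uniformly_transversally_bounded L"
    and ne: "nonempty_subset_family L I X"
    and bd: "\<And>x. x \<in> transversals I X \<Longrightarrow> bounded_transversal L I x"
  shows "\<exists>J\<subseteq>I. finite (I - J) \<and> \<Squnion>\<^bsub>L\<^esub>(\<Union>i\<in>J. X i) \<sqsubset>\<^bsub>L\<^esub> \<top>\<^bsub>L\<^esub>"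
proof -
  interpret complete_lattice L by (rule L)
  let ?fib = "\<lambda>A. {i \<in> I. X i = A}"
  let ?K = "{(A, n :: nat). A \<in> X ` I \<and> (finite (?fib A) \<longrightarrow> n < card (?fib A))}"
  obtain g where g: "inj_on g ?K" "\<And>k. k \<in> ?K \<Longrightarrow> g k \<in> I" "\<And>k. k \<in> ?K \<Longrightarrow> X (g k) = fst k"
    using family_reindex by blast
  obtain M where M: "M \<subseteq> ?K" "finite (?K - M)" "\<Squnion>\<^bsub>L\<^esub>(\<Union>k\<in>M. fst k) \<sqsubset>\<^bsub>L\<^esub> \<top>\<^bsub>L\<^esub>"
    using utb transversals_reindex[OF ne bd g] unfolding uniformly_transversally_bounded_def by blast
  define J where "J = {i \<in> I. X i \<in> fst ` M}"
  have zero: "(X i, 0) \<in> ?K" if "i \<in> I" for i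
    using that by (auto simp: card_gt_0_iff)
  have out: "(X i, n) \<in> ?K - M" if "i \<in> I - J" "(X i, n) \<in> ?K" for i n
    using that unfolding J_def by force
  have fibfin: "finite (?fib (X i))" if i: "i \<in> I - J" for i
  proof (rule ccontr)
    assume "\<not> ?thesis"
    then have "range (Pair (X i)) \<subseteq> ?K - M" using i out[OF i] by auto
    then have "finite (range (Pair (X i) :: nat \<Rightarrow> _))" using M(2) finite_subset by blast
    then show False by (simp add: finite_image_iff inj_on_def)
  qed
  have "X ` (I - J) \<subseteq> fst ` (?K - M)"
  proof
    fix A assume "A \<in> X ` (I - J)"
    then obtain i where i: "i \<in> I - J" "A = X i" by blast
    then show "A \<in> fst ` (?K - M)"
      using out[OF i(1) zero] by (intro image_eqI[of _ _ "(X i, 0)"]) auto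
  qed
  then have "finite (X ` (I - J))" using M(2) finite_subset by blast
  then have "finite (\<Union>A\<in>X ` (I - J). ?fib A)" using fibfin by blast
  then have "finite (I - J)" by (rule rev_finite_subset) auto
  moreover have "X ` J = fst ` M"
  proof
    show "X ` J \<subseteq> fst ` M" unfolding J_def by blast
    have "fst k \<in> X ` J" if "k \<in> M" for k
    proof -
      have "fst k \<in> X ` I" using M(1) that by (auto dest!: subsetD[of M])
      then obtain i where "i \<in> I" "fst k = X i" by blast
      then show ?thesis using that unfolding J_def by (metis (mono_tags, lifting) imageI mem_Collect_eq)
    qed
    then show "fst ` M \<subseteq> X ` J" by blast
  qed
  moreover have "J \<subseteq> I" unfolding J_def by blast
  ultimately show ?thesis using M(3) by (intro exI[of _ J]) simp
qed


section \<open>The dual of the lattice of ideals\<close>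

definition ideal_lattice :: "('a, 'b) ring_scheme \<Rightarrow> 'a set gorder" where
  "ideal_lattice R = \<lparr>carrier = {I. ideal I R}, eq = (=), le = (\<subseteq>)\<rparr>"

definition dual_ideal_lattice :: "('a, 'b) ring_scheme \<Rightarrow> 'a set gorder" where
  "dual_ideal_lattice R = inv_gorder (ideal_lattice R)"

lemma dual_ideal_lattice_simps [simp]:
  "carrier (dual_ideal_lattice R) = {I. ideal I R}"
  "I \<sqsubseteq>\<^bsub>dual_ideal_lattice R\<^esub> J \<longleftrightarrow> J \<subseteq> I"
  "I .=\<^bsub>dual_ideal_lattice R\<^esub> J \<longleftrightarrow> I = J"
  "I \<sqsubset>\<^bsub>dual_ideal_lattice R\<^esub> J \<longleftrightarrow> J \<subset> I"
  by (auto simp: dual_ideal_lattice_def ideal_lattice_def lless_def)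

context ring
begin

lemma least_Upper_dual_ideal_lattice:
  assumes "S \<subseteq> {I. ideal I R}"
  shows "least (dual_ideal_lattice R) (\<Inter>S \<inter> carrier R) (Upper (dual_ideal_lattice R) S)"
proof -
  have "ideal (\<Inter>S \<inter> carrier R) R"
  proof -
    have "\<Inter>S \<inter> carrier R = \<Inter>(insert (carrier R) S)" by blast
    then show ?thesis using i_Intersect[of "insert (carrier R) S"] assms oneideal by auto
  qed
  then show ?thesis using assms
    by (auto simp: least_def Upper_def dest: ideal.Icarr)
qed

lemma complete_lattice_dual_ideal_lattice: "complete_lattice (dual_ideal_lattice R)"
proof -
  interpret partial_order "dual_ideal_lattice R"
    by unfold_locales (auto simp: fun_eq_iff)
  show ?thesis
  proof
    fix S assume "S \<subseteq> carrier (dual_ideal_lattice R)"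
    then have S: "S \<subseteq> {I. ideal I R}" by simp
    show "\<exists>s. least (dual_ideal_lattice R) s (Upper (dual_ideal_lattice R) S)"
      using least_Upper_dual_ideal_lattice[OF S] by blast
    let ?T = "Lower (dual_ideal_lattice R) S"
    have T: "?T \<subseteq> {I. ideal I R}" by (auto simp: Lower_def)
    have "greatest (dual_ideal_lattice R) (\<Inter>?T \<inter> carrier R) ?T"
      using least_Upper_dual_ideal_lattice[OF T] S
      by (auto simp: least_def greatest_def Upper_def Lower_def dest: ideal.Icarr)
    then show "\<exists>i. greatest (dual_ideal_lattice R) i ?T" by blast
  qed
qed

lemma sup_dual_ideal_lattice:
  assumes "S \<subseteq> {I. ideal I R}"
  shows "\<Squnion>\<^bsub>dual_ideal_lattice R\<^esub>S = \<Inter>S \<inter> carrier R"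
proof -
  interpret complete_lattice "dual_ideal_lattice R" by (rule complete_lattice_dual_ideal_lattice)
  show ?thesis
    unfolding sup_def
  proof (rule some_equality)
    show "least (dual_ideal_lattice R) (\<Inter>S \<inter> carrier R) (Upper (dual_ideal_lattice R) S)"
      by (rule least_Upper_dual_ideal_lattice[OF assms])
  qed (rule least_unique[OF _ least_Upper_dual_ideal_lattice[OF assms]])
qed

lemma top_dual_ideal_lattice: "\<top>\<^bsub>dual_ideal_lattice R\<^esub> = {\<zero>}"
proof -
  interpret complete_lattice "dual_ideal_lattice R" by (rule complete_lattice_dual_ideal_lattice)
  have "ideal \<top>\<^bsub>dual_ideal_lattice R\<^esub> R"
    using top_closed by simp
  then have "\<zero> \<in> \<top>\<^bsub>dual_ideal_lattice R\<^esub>"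
    using additive_subgroup.zero_closed ideal.axioms(1) by blast
  moreover have "\<top>\<^bsub>dual_ideal_lattice R\<^esub> \<subseteq> {\<zero>}"
    using top_higher[of "{\<zero>}"] zeroideal by simp
  ultimately show ?thesis by blast
qed

end

lemma (in domain) top_join_irreducible_dual_ideal_lattice:
  "top_join_irreducible (dual_ideal_lattice R)"
  unfolding top_join_irreducible_def
proof (intro ballI impI)
  fix I J
  assume "I \<in> carrier (dual_ideal_lattice R)" "J \<in> carrier (dual_ideal_lattice R)"
    and I: "I \<sqsubset>\<^bsub>dual_ideal_lattice R\<^esub> \<top>\<^bsub>dual_ideal_lattice R\<^esub>"
    and J: "J \<sqsubset>\<^bsub>dual_ideal_lattice R\<^esub> \<top>\<^bsub>dual_ideal_lattice R\<^esub>"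
  then have id: "ideal I R" "ideal J R" by auto
  obtain a where a: "a \<in> I" "a \<noteq> \<zero>" using I by (auto simp: top_dual_ideal_lattice)
  obtain b where b: "b \<in> J" "b \<noteq> \<zero>" using J by (auto simp: top_dual_ideal_lattice)
  have c: "a \<in> carrier R" "b \<in> carrier R" using a b id by (auto dest: ideal.Icarr)
  have "a \<otimes> b \<in> I \<inter> J \<inter> carrier R"
    using a b c id ideal.I_l_closed ideal.I_r_closed by fastforce
  moreover have "a \<otimes> b \<noteq> \<zero>" using a b c integral by blast
  moreover have "I \<squnion>\<^bsub>dual_ideal_lattice R\<^esub> J = I \<inter> J \<inter> carrier R"
    using id by (simp add: join_def sup_dual_ideal_lattice)
  ultimately show "I \<squnion>\<^bsub>dual_ideal_lattice R\<^esub> J \<noteq> \<top>\<^bsub>dual_ideal_lattice R\<^esub>"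
    unfolding top_dual_ideal_lattice by blast
qed

end

theory Submission
  imports Defs "HOL-Library.Countable_Set"
begin

text \<open>
  Suppose the lattice is transversally bounded, but not uniformly. Transversal boundedness, applied
  to a constant sequence, shows that a set of ideals with zero intersection has a countable subset
  with zero intersection, so a counterexample may be taken to consist of columns \<open>X i\<close>, \<open>i\<close> a natural
  number, with countable union. Call a set \<open>D\<close> of columns null if the ideals in the columns from \<open>D\<close>
  have nonzero intersection. Decreasing sequences of non-null sets have non-null
  pseudointersections.

  If some non-null \<open>U\<close> could not be split into two non-null sets, the null subsets of \<open>U\<close> would form
  a maximal ideal that is a P-ideal. The ideals of ring elements lying in \<open>\<Inter>(X i)\<close> for
  almost all \<open>i \<in> D\<close>, with \<open>D \<subseteq> U\<close> null, would then have zero intersection, but no countable set of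
  them would. So every non-null set splits, and a binary tree of splittings yields pairwise almost
  disjoint non-null sets \<open>U a\<close>, one for each \<open>a :: nat \<Rightarrow> bool\<close>.

  Since there are also at most continuum many subsets of the countable set of all ideals involved,
  one can choose a transversal \<open>p a\<close> for each \<open>a\<close> so that every nonzero ring element avoids
  infinitely many \<open>p a i\<close>, \<open>i \<in> U a\<close>, for some \<open>a\<close>. Thus the ideals of elements that lie in \<open>p a i\<close> for
  almost all \<open>i \<in> U a\<close> have zero intersection. But countably many of the \<open>U a\<close> become disjoint after
  removing finite sets, so countably many of these \<open>p a\<close> are merged into one transversal, which is
  bounded: a contradiction.
\<close>

section \<open>Bounded sets of ideals and eventual membership\<close>

context ring
begin

text \<open>For a set of ideals this says that its join in the dual lattice is below the top,
  expressed by a nonzero common element.\<close>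

definition bounded_ideals :: "'a set set \<Rightarrow> bool" where
  "bounded_ideals S \<longleftrightarrow> (\<exists>r\<in>carrier R - {\<zero>}. \<forall>x\<in>S. r \<in> x)"

text \<open>Membership up to finitely many exceptions is turned into an ideal, so that transversal
  boundedness can be applied to sets of such ideals.\<close>

definition eventual_ideal :: "('i \<Rightarrow> 'a set) \<Rightarrow> 'i set \<Rightarrow> 'a set" where
  "eventual_ideal f V = {r \<in> carrier R. finite {i \<in> V. r \<notin> f i}}"

lemma bounded_ideals_subset: "bounded_ideals T \<Longrightarrow> S \<subseteq> T \<Longrightarrow> bounded_ideals S"
  unfolding bounded_ideals_def by blast

lemma sup_less_top_iff_bounded_ideals:
  assumes "S \<subseteq> {I. ideal I R}"
  shows "\<Squnion>\<^bsub>dual_ideal_lattice R\<^esub>S \<sqsubset>\<^bsub>dual_ideal_lattice R\<^esub> \<top>\<^bsub>dual_ideal_lattice R\<^esub>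
    \<longleftrightarrow> bounded_ideals S"
proof -
  have "\<zero> \<in> x" if "x \<in> S" for x
    using that assms additive_subgroup.zero_closed ideal.axioms(1) by blast
  then show ?thesis
    unfolding sup_dual_ideal_lattice[OF assms] top_dual_ideal_lattice bounded_ideals_def
    by (auto simp: psubset_eq)
qed

lemma ideal_eventual_ideal:
  assumes "\<And>i. i \<in> V \<Longrightarrow> ideal (f i) R"
  shows "ideal (eventual_ideal f V) R"
proof (rule idealI)
  show "ring R" by (rule ring_axioms)
  show "subgroup (eventual_ideal f V) (add_monoid R)"
  proof (rule group.subgroupI)
    show "Group.group (add_monoid R)" by (rule a_group)
    show "eventual_ideal f V \<subseteq> carrier (add_monoid R)" by (auto simp: eventual_ideal_def)
    have "\<zero> \<in> f i" if "i \<in> V" for i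
      by (rule additive_subgroup.zero_closed[OF ideal.axioms(1)[OF assms[OF that]]])
    then have e: "{i \<in> V. \<zero> \<notin> f i} = {}" by blast
    have "\<zero> \<in> eventual_ideal f V" unfolding eventual_ideal_def by (simp add: e)
    then show "eventual_ideal f V \<noteq> {}" by blast
  next
    fix r assume r: "r \<in> eventual_ideal f V"
    have "\<ominus> r \<in> f i" if "i \<in> V" "r \<in> f i" for i
      by (rule additive_subgroup.a_inv_closed[OF ideal.axioms(1)[OF assms[OF that(1)]] that(2)])
    then have "{i \<in> V. \<ominus> r \<notin> f i} \<subseteq> {i \<in> V. r \<notin> f i}" by blast
    then have "finite {i \<in> V. \<ominus> r \<notin> f i}"
      by (rule finite_subset) (use r in \<open>simp add: eventual_ideal_def\<close>)
    then show "inv\<^bsub>add_monoid R\<^esub> r \<in> eventual_ideal f V"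
      using r by (simp add: eventual_ideal_def flip: a_inv_def)
  next
    fix r s assume r: "r \<in> eventual_ideal f V" and s: "s \<in> eventual_ideal f V"
    have "r \<oplus> s \<in> f i" if "i \<in> V" "r \<in> f i" "s \<in> f i" for i
      by (rule additive_subgroup.a_closed[OF ideal.axioms(1)[OF assms[OF that(1)]] that(2,3)])
    then have "{i \<in> V. r \<oplus> s \<notin> f i} \<subseteq> {i \<in> V. r \<notin> f i} \<union> {i \<in> V. s \<notin> f i}" by blast
    then have "finite {i \<in> V. r \<oplus> s \<notin> f i}"
      by (rule finite_subset) (use r s in \<open>simp add: eventual_ideal_def\<close>)
    then show "r \<otimes>\<^bsub>add_monoid R\<^esub> s \<in> eventual_ideal f V"
      using r s by (simp add: eventual_ideal_def)
  qed
next
  fix a x assume a: "a \<in> eventual_ideal f V" and x: "x \<in> carrier R"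
  have "x \<otimes> a \<in> f i" "a \<otimes> x \<in> f i" if "i \<in> V" "a \<in> f i" for i
    using ideal.I_l_closed[OF assms[OF that(1)] that(2) x]
      ideal.I_r_closed[OF assms[OF that(1)] that(2) x] by auto
  then have sub: "{i \<in> V. x \<otimes> a \<notin> f i} \<subseteq> {i \<in> V. a \<notin> f i}"
    "{i \<in> V. a \<otimes> x \<notin> f i} \<subseteq> {i \<in> V. a \<notin> f i}" by blast+
  have "finite {i \<in> V. a \<notin> f i}" using a by (simp add: eventual_ideal_def)
  then have "finite {i \<in> V. x \<otimes> a \<notin> f i}" "finite {i \<in> V. a \<otimes> x \<notin> f i}"
    using sub by (simp_all add: finite_subset)
  then show "x \<otimes> a \<in> eventual_ideal f V" "a \<otimes> x \<in> eventual_ideal f V"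
    using a x by (simp_all add: eventual_ideal_def)
qed

text \<open>The contrapositive of transversal boundedness. For constant \<open>Y\<close> it extracts
  a countable unbounded subset.\<close>

lemma transversally_bounded_sequence:
  fixes Y :: "nat \<Rightarrow> 'a set set"
  assumes "transversally_bounded (dual_ideal_lattice R)"
    and Y: "\<And>n. Y n \<subseteq> {I. ideal I R}" "\<And>n. Y n \<noteq> {}" "\<And>n. \<not> bounded_ideals (Y n)"
  obtains y where "\<And>n. y n \<in> Y n" "\<not> bounded_ideals (range y)"
proof (rule ccontr)
  assume "\<not> thesis"
  then have no: "bounded_ideals (range y)" if "\<And>n. y n \<in> Y n" for y
    using that \<open>\<And>y. (\<And>n. y n \<in> Y n) \<Longrightarrow> \<not> bounded_ideals (range y) \<Longrightarrow> thesis\<close> by blast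
  have "bounded_transversal (dual_ideal_lattice R) UNIV y" if "y \<in> transversals UNIV Y" for y
  proof -
    have y: "y n \<in> Y n" for n using that by (auto simp: transversals_def)
    then have "bounded_ideals (range y)" by (rule no)
    then show ?thesis unfolding bounded_transversal_def
      using y Y(1) by (subst sup_less_top_iff_bounded_ideals) auto
  qed
  then have "finite {n \<in> UNIV. \<not> \<Squnion>\<^bsub>dual_ideal_lattice R\<^esub>(Y n)
      \<sqsubset>\<^bsub>dual_ideal_lattice R\<^esub> \<top>\<^bsub>dual_ideal_lattice R\<^esub>}"
    using Y(1,2)
    by (intro transversally_bounded_any_index[OF complete_lattice_dual_ideal_lattice assms(1)])
      (auto simp: nonempty_subset_family_def)
  then show False using Y(3) sup_less_top_iff_bounded_ideals[OF Y(1)] by simp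
qed

end

context domain
begin

lemma bounded_ideals_empty: "bounded_ideals {}"
  unfolding bounded_ideals_def by auto

text \<open>The product of a witness for \<open>S\<close> and one for \<open>T\<close> lies in every
  ideal of the union, and it is nonzero in a domain.\<close>

lemma bounded_ideals_Un:
  assumes "bounded_ideals S" "bounded_ideals T" "S \<subseteq> {I. ideal I R}" "T \<subseteq> {I. ideal I R}"
  shows "bounded_ideals (S \<union> T)"
proof -
  obtain r s where r: "r \<in> carrier R - {\<zero>}" "\<forall>x\<in>S. r \<in> x"
    and s: "s \<in> carrier R - {\<zero>}" "\<forall>x\<in>T. s \<in> x"
    using assms(1,2) unfolding bounded_ideals_def by blast
  have "r \<otimes> s \<in> x" if "x \<in> S \<union> T" for x
    using that
  proof
    assume "x \<in> S"
    then show ?thesis using r s assms(3) ideal.I_r_closed[of x R r s] by blast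
  next
    assume "x \<in> T"
    then show ?thesis using r s assms(4) ideal.I_l_closed[of x R s r] by blast
  qed
  moreover have "r \<otimes> s \<in> carrier R - {\<zero>}" using r s integral by auto
  ultimately show ?thesis unfolding bounded_ideals_def by blast
qed

lemma bounded_ideals_UN_finite:
  assumes "finite D" "\<And>i. i \<in> D \<Longrightarrow> bounded_ideals (X i)"
    "\<And>i. i \<in> D \<Longrightarrow> X i \<subseteq> {I. ideal I R}"
  shows "bounded_ideals (\<Union>i\<in>D. X i)"
  using assms
proof (induction D)
  case empty
  then show ?case by (simp add: bounded_ideals_empty)
next
  case (insert i D)
  have "bounded_ideals (X i \<union> (\<Union>i\<in>D. X i))"
    by (rule bounded_ideals_Un) (use insert in auto)
  then show ?case by simp
qed

end

section \<open>Null sets of columns in a countable counterexample\<close>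

locale counterexample = domain +
  fixes X :: "nat \<Rightarrow> 'a set set"
  assumes tb: "transversally_bounded (dual_ideal_lattice R)"
    and X_ideals: "X i \<subseteq> {I. ideal I R}"
    and X_nonempty: "X i \<noteq> {}"
    and X_bounded: "bounded_ideals (X i)"
    and X_countable: "countable (\<Union>i. X i)"
    and X_transversal: "(\<And>i. c i \<in> X i) \<Longrightarrow> bounded_ideals (range c)"
    and X_unbounded: "\<not> bounded_ideals (\<Union>i. X i)"
begin

definition null :: "nat set \<Rightarrow> bool" where
  "null D \<longleftrightarrow> bounded_ideals (\<Union>i\<in>D. X i)"

text \<open>The join of the column \<open>X i\<close> in the dual lattice. These ideals alone
  determine which sets of columns are null.\<close>

definition A :: "nat \<Rightarrow> 'a set" where
  "A i = carrier R \<inter> \<Inter>(X i)"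

lemma ideal_A: "ideal (A i) R"
proof -
  have "ideal (\<Inter>(insert (carrier R) (X i))) R"
    using X_ideals[of i] oneideal by (intro i_Intersect) auto
  then show ?thesis unfolding A_def by simp
qed

lemma null_iff: "null D \<longleftrightarrow> (\<exists>r\<in>carrier R - {\<zero>}. \<forall>i\<in>D. r \<in> A i)"
  unfolding null_def bounded_ideals_def A_def by blast

lemma null_iff_bounded_image: "null D \<longleftrightarrow> bounded_ideals (A ` D)"
  unfolding null_iff bounded_ideals_def by blast

lemma null_subset: "null E \<Longrightarrow> D \<subseteq> E \<Longrightarrow> null D"
  unfolding null_iff by blast

lemma null_Un: "null D \<Longrightarrow> null E \<Longrightarrow> null (D \<union> E)"
  unfolding null_def using X_ideals bounded_ideals_Un[of "\<Union>(X ` D)" "\<Union>(X ` E)"]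
  by (simp add: UN_Un SUP_le_iff)

lemma null_finite: "finite D \<Longrightarrow> null D"
  unfolding null_def using X_ideals X_bounded by (intro bounded_ideals_UN_finite)

lemma not_null_Diff: "\<not> null D \<Longrightarrow> null E \<Longrightarrow> \<not> null (D - E)"
  using null_Un[of "D - E" E] null_subset[of "D - E \<union> E" D] by blast

text \<open>Some choice of \<open>k n\<close> in \<open>U n\<close> makes the ideals
  \<open>A (k n)\<close> jointly unbounded, so \<open>range k\<close> is non-null. As
  \<open>U\<close> decreases, only \<open>k l\<close> with \<open>l < n\<close> can lie outside
  \<open>U n\<close>.\<close>

lemma not_null_pseudointersection:
  fixes U :: "nat \<Rightarrow> nat set"
  assumes "\<And>n. \<not> null (U n)" "antimono U"
  obtains V where "\<not> null V" "\<And>n. finite (V - U n)"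
proof -
  have ne: "A ` U n \<noteq> {}" for n using assms(1)[of n] null_finite by auto
  obtain y where y: "\<And>n. y n \<in> A ` U n" "\<not> bounded_ideals (range y)"
    using transversally_bounded_sequence[OF tb, of "\<lambda>n. A ` U n"] assms(1) ideal_A ne
    unfolding null_iff_bounded_image by blast
  obtain k where k: "\<And>n. k n \<in> U n" "\<And>n. y n = A (k n)"
    using y(1) unfolding image_iff by metis
  have "range y = A ` range k" using k by auto
  then have "\<not> null (range k)" using y(2) null_iff_bounded_image by simp
  moreover have "range k - U n \<subseteq> k ` {..<n}" for n
  proof
    fix i assume i: "i \<in> range k - U n"
    then obtain l where l: "i = k l" by blast
    have "l < n" using i k(1)[of l] antimonoD[OF assms(2), of n l] unfolding l
      by (auto simp: not_less[symmetric])
    then show "i \<in> k ` {..<n}" unfolding l by blast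
  qed
  then have "finite (range k - U n)" for n by (rule finite_subset) simp
  ultimately show thesis using that by blast
qed

lemma not_null_split:
  assumes U: "\<not> null U"
  obtains D where "D \<subseteq> U" "\<not> null D" "\<not> null (U - D)"
proof (rule ccontr)
  assume "\<not> thesis"
  then have ultra: "null D \<or> null (U - D)" if "D \<subseteq> U" for D
    using that \<open>\<And>D. D \<subseteq> U \<Longrightarrow> \<not> null D \<Longrightarrow> \<not> null (U - D) \<Longrightarrow> thesis\<close> by blast
  \<comment> \<open>The subsets of \<open>U\<close> with null complement form an ultrafilter, and it is a P-point.\<close>
  let ?Y = "eventual_ideal A ` {D. D \<subseteq> U \<and> null D}"
  have "\<not> bounded_ideals ?Y"
  proof
    assume "bounded_ideals ?Y"
    then obtain r where r: "r \<in> carrier R - {\<zero>}"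
      and ev: "\<And>D. D \<subseteq> U \<Longrightarrow> null D \<Longrightarrow> r \<in> eventual_ideal A D"
      unfolding bounded_ideals_def by auto
    let ?S = "{i \<in> U. r \<notin> A i}"
    have "null {i. r \<in> A i}" using r unfolding null_iff by blast
    moreover have "?S = U - {i. r \<in> A i}" by blast
    ultimately have "\<not> null ?S" using not_null_Diff[OF U] by simp
    then have "infinite ?S" using null_finite by blast
    then obtain f :: "nat \<Rightarrow> nat" where f: "inj f" "range f \<subseteq> ?S"
      using infinite_countable_subset by blast
    \<comment> \<open>Two disjoint infinite sets of columns \<open>i\<close> with \<open>r\<close>
      outside \<open>A i\<close>. Since \<open>U\<close> does not split, one of them is null, which
      contradicts \<open>ev\<close>.\<close>
    define S where "S b = f ` {n. even n = b}" for b
    have inf: "infinite (S b)" for b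
    proof -
      have "infinite {n :: nat. even n = b}"
      proof (cases b)
        case True
        have "range (\<lambda>n :: nat. 2 * n) \<subseteq> {n. even n = b}" using True by auto
        then show ?thesis using finite_subset range_inj_infinite[of "\<lambda>n :: nat. 2 * n"]
          by (auto simp: inj_on_def)
      next
        case False
        have "range (\<lambda>n :: nat. Suc (2 * n)) \<subseteq> {n. even n = b}" using False by auto
        then show ?thesis using finite_subset range_inj_infinite[of "\<lambda>n :: nat. Suc (2 * n)"]
          by (auto simp: inj_on_def)
      qed
      then show ?thesis unfolding S_def using f(1) by (metis finite_imageD inj_on_subset subset_UNIV)
    qed
    have sub: "S b \<subseteq> ?S" for b using f(2) unfolding S_def by blast
    have "S True \<inter> S False = {}" unfolding S_def using f(1) by (auto simp: inj_def)
    then have "S False \<subseteq> U - S True" using sub[of False] by blast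
    then obtain b where b: "null (S b)" using ultra[of "S True"] sub[of True] null_subset by blast
    have "r \<in> eventual_ideal A (S b)" using ev b sub[of b] by blast
    moreover have "{i \<in> S b. r \<notin> A i} = S b" using sub[of b] by blast
    ultimately show False using inf unfolding eventual_ideal_def by simp
  qed
  moreover have "?Y \<noteq> {}" using null_finite[of "{}"] by blast
  moreover have "?Y \<subseteq> {I. ideal I R}" 
    using ideal_eventual_ideal[of _ A] ideal_A by blast
  ultimately obtain y where y: "\<And>n :: nat. y n \<in> ?Y" "\<not> bounded_ideals (range y)"
    using transversally_bounded_sequence[OF tb, of "\<lambda>_. ?Y"] by blast
  have "\<forall>n. \<exists>D. (D \<subseteq> U \<and> null D) \<and> y n = eventual_ideal A D" using y(1) by blast
  then obtain D where D: "\<And>n. D n \<subseteq> U" "\<And>n. null (D n)" "\<And>n. y n = eventual_ideal A (D n)"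
    by metis
  have fin: "null (\<Union>m<n. D m)" for n
    by (induction n) (auto simp: lessThan_Suc null_Un D null_finite)
  \<comment> \<open>The pseudointersection \<open>V\<close> meets each \<open>D n\<close> in a
    finite set, while \<open>U - V\<close> is null because \<open>U\<close> does not split. A
    witness \<open>r\<close> for \<open>U - V\<close> then lies in \<open>A i\<close> for almost all
    \<open>i\<close> in every \<open>D n\<close>.\<close>
  have "antimono (\<lambda>n. U - (\<Union>m<n. D m))" by (force simp: antimono_def monotone_def)
  then obtain V where V: "\<not> null V" "\<And>n. finite (V - (U - (\<Union>m<n. D m)))"
    using not_null_pseudointersection[of "\<lambda>n. U - (\<Union>m<n. D m)"] not_null_Diff[OF U fin] by blast
  \<comment> \<open>At \<open>n = 0\<close> the union is empty, so \<open>V - U\<close> is finite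
    and can be discarded.\<close>
  have "\<not> null (V - (V - U))" using V(2)[of 0] by (intro not_null_Diff V null_finite) simp
  then have "null (U - V)" using ultra[of "U \<inter> V"]
    by (simp add: Diff_Diff_Int Int_commute Diff_Int)
  then obtain r where r: "r \<in> carrier R - {\<zero>}" "\<forall>i\<in>U - V. r \<in> A i" unfolding null_iff by blast
  have "r \<in> y n" for n
  proof -
    have "{i \<in> D n. r \<notin> A i} \<subseteq> V - (U - (\<Union>m<Suc n. D m))" using r(2) D(1)[of n] by auto
    then show ?thesis unfolding D(3) eventual_ideal_def using r(1) V(2) finite_subset by blast
  qed
  then show False using y(2) r(1) unfolding bounded_ideals_def by blast
qed

section \<open>Almost disjoint non-null sets from a binary tree\<close>

lemma almost_disjoint_not_null:
  obtains U :: "(nat \<Rightarrow> bool) \<Rightarrow> nat set"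
  where "\<And>a. \<not> null (U a)" "\<And>a b. a \<noteq> b \<Longrightarrow> finite (U a \<inter> U b)"
proof -
  have "\<forall>U. \<exists>D. \<not> null U \<longrightarrow> D \<subseteq> U \<and> \<not> null D \<and> \<not> null (U - D)"
    using not_null_split by metis
  then obtain h where h: "\<And>U. \<not> null U \<Longrightarrow> h U \<subseteq> U"
    "\<And>U. \<not> null U \<Longrightarrow> \<not> null (h U)" "\<And>U. \<not> null U \<Longrightarrow> \<not> null (U - h U)"
    by metis
  \<comment> \<open>The node at depth \<open>n\<close> on the branch \<open>a\<close>. Two branches
    are disjoint from the level after their first difference on.\<close>
  define T where "T a = rec_nat UNIV (\<lambda>n U. if a n then h U else U - h U)" for a :: "nat \<Rightarrow> bool"
  have T0: "T a 0 = UNIV" and TS: "T a (Suc n) = (if a n then h (T a n) else T a n - h (T a n))"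
    for a n by (simp_all add: T_def)
  have Tnn: "\<not> null (T a n)" for a n
    by (induction n) (use X_unbounded h in \<open>auto simp: T0 TS null_def\<close>)
  have dec: "antimono (T a)" for a
    unfolding antimono_iff_le_Suc using h(1)[OF Tnn] by (auto simp: TS)
  have agree: "T a n = T b n" if "\<And>m. m < n \<Longrightarrow> a m = b m" for a b n
    using that by (induction n) (simp_all add: T0 TS)
  have disj: "\<exists>n. T a n \<inter> T b n = {}" if "a \<noteq> b" for a b
  proof -
    define n where "n = (LEAST n. a n \<noteq> b n)"
    have "\<exists>n. a n \<noteq> b n" using that by blast
    then have n: "a n \<noteq> b n" unfolding n_def by (rule LeastI_ex)
    have "T a n = T b n" by (rule agree) (use not_less_Least in \<open>auto simp: n_def\<close>)
    then have "T a (Suc n) \<inter> T b (Suc n) = {}" using n by (auto simp: TS)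
    then show ?thesis by blast
  qed
  have "\<forall>a. \<exists>V. \<not> null V \<and> (\<forall>n. finite (V - T a n))"
    using not_null_pseudointersection[OF Tnn dec] by metis
  then obtain U where U: "\<And>a. \<not> null (U a)" "\<And>a n. finite (U a - T a n)" by metis
  show thesis
  proof
    show "\<not> null (U a)" for a by (rule U)
    show "finite (U a \<inter> U b)" if "a \<noteq> b" for a b
    proof -
      obtain n where "T a n \<inter> T b n = {}" using disj[OF \<open>a \<noteq> b\<close>] by blast
      then have "U a \<inter> U b \<subseteq> (U a - T a n) \<union> (U b - T b n)" by blast
      then show ?thesis using U(2) finite_subset by blast
    qed
  qed
qed

section \<open>Diagonalization over the branches\<close>

lemma contradiction: False
proof -
  obtain U :: "(nat \<Rightarrow> bool) \<Rightarrow> nat set"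
    where U: "\<And>a. \<not> null (U a)" "\<And>a b. a \<noteq> b \<Longrightarrow> finite (U a \<inter> U b)"
    using almost_disjoint_not_null by blast
  define e where "e = to_nat_on (\<Union>i. X i)"
  have e: "inj_on e (\<Union>i. X i)" unfolding e_def by (rule inj_on_to_nat_on[OF X_countable])
  \<comment> \<open>\<open>a\<close> codes the set of ideals \<open>x\<close> with \<open>a (e x)\<close>; the transversal \<open>p a\<close> picks members of it.\<close>
  define p where "p a i = (SOME x. x \<in> X i \<and> ((\<exists>z\<in>X i. a (e z)) \<longrightarrow> a (e x)))" for a i
  have p: "p a i \<in> X i \<and> ((\<exists>z\<in>X i. a (e z)) \<longrightarrow> a (e (p a i)))" for a i
    unfolding p_def by (rule someI_ex) (use X_nonempty in blast)
  let ?Y = "range (\<lambda>a. eventual_ideal (p a) (U a))"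
  have "\<not> bounded_ideals ?Y"
  proof
    assume "bounded_ideals ?Y"
    then obtain r where r: "r \<in> carrier R - {\<zero>}" "\<And>a. r \<in> eventual_ideal (p a) (U a)"
      unfolding bounded_ideals_def by auto
    \<comment> \<open>The branch coding the ideals that miss \<open>r\<close>: on it,
      \<open>p a i\<close> avoids \<open>r\<close> whenever some ideal in \<open>X i\<close>
      does.\<close>
    define a where "a n \<longleftrightarrow> (\<exists>x\<in>\<Union>i. X i. e x = n \<and> r \<notin> x)" for n
    have a: "a (e x) \<longleftrightarrow> r \<notin> x" if "x \<in> X i" for x i
      using that e unfolding a_def inj_on_def by blast
    have "r \<notin> p a i" if "r \<notin> A i" for i
      using that p[of a i] a[of _ i] r(1) unfolding A_def by blast
    then have "{i \<in> U a. r \<notin> A i} \<subseteq> {i \<in> U a. r \<notin> p a i}" by blast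
    then have "finite {i \<in> U a. r \<notin> A i}"
      using r(2)[of a] finite_subset unfolding eventual_ideal_def by blast
    moreover have "{i \<in> U a. r \<notin> A i} = U a - {i. r \<in> A i}" by blast
    moreover have "null {i. r \<in> A i}" using r unfolding null_iff by blast
    ultimately show False using not_null_Diff[OF U(1)] null_finite by metis
  qed
  moreover have "ideal (p a i) R" for a i using p[of a i] X_ideals[of i] by auto
  then have "?Y \<subseteq> {I. ideal I R}" by (auto intro: ideal_eventual_ideal)
  ultimately obtain y where y: "\<And>n :: nat. y n \<in> ?Y" "\<not> bounded_ideals (range y)"
    using transversally_bounded_sequence[OF tb, of "\<lambda>_. ?Y"] by blast
  have "\<forall>n. \<exists>a. y n = eventual_ideal (p a) (U a)" using y(1) by blast
  then obtain a where a: "\<And>n. y n = eventual_ideal (p (a n)) (U (a n))" by metis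
  \<comment> \<open>Each column follows the first \<open>U (a n)\<close> containing it. For a column
    in none of them \<open>m i\<close> is arbitrary, but \<open>c i\<close> still lies in
    \<open>X i\<close>.\<close>
  define m where "m i = (LEAST n. i \<in> U (a n))" for i
  define c where "c i = p (a (m i)) i" for i
  have "bounded_ideals (range c)" using p by (intro X_transversal) (simp add: c_def)
  then obtain r where r: "r \<in> carrier R - {\<zero>}" "\<And>i. r \<in> c i"
    unfolding bounded_ideals_def by auto
  have "r \<in> y n" for n
  proof -
    \<comment> \<open>Exceptions occur only in columns claimed by an earlier, different branch.
      Repetitions \<open>a k = a n\<close> must be left out, since \<open>U (a n)\<close> is
      infinite, but there \<open>c\<close> agrees with \<open>p (a n)\<close>.\<close>
    have "i \<in> (\<Union>k\<in>{k. k < n \<and> a k \<noteq> a n}. U (a n) \<inter> U (a k))"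
      if i: "i \<in> U (a n)" "r \<notin> p (a n) i" for i
    proof -
      have "i \<in> U (a (m i))" "m i \<le> n" using i(1) unfolding m_def by (rule LeastI, rule Least_le)
      moreover have "a (m i) \<noteq> a n" using r(2)[of i] i(2) unfolding c_def by auto
      ultimately show ?thesis using i(1) by (auto simp: le_less)
    qed
    then have "{i \<in> U (a n). r \<notin> p (a n) i} \<subseteq> (\<Union>k\<in>{k. k < n \<and> a k \<noteq> a n}. U (a n) \<inter> U (a k))"
      by blast
    moreover have "finite (\<Union>k\<in>{k. k < n \<and> a k \<noteq> a n}. U (a n) \<inter> U (a k))"
      using U(2) by (intro finite_UN_I) auto
    ultimately show ?thesis using r(1) unfolding a eventual_ideal_def
      using finite_subset by blast
  qed
  then show False using y(2) r(1) unfolding bounded_ideals_def by blast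
qed

end

section \<open>Reduction to countably many columns\<close>

lemma (in domain) bounded_ideals_UN:
  fixes X :: "'i \<Rightarrow> 'a set set"
  assumes tb: "transversally_bounded (dual_ideal_lattice R)"
    and X: "\<And>i. i \<in> J \<Longrightarrow> X i \<subseteq> {I. ideal I R}" "\<And>i. i \<in> J \<Longrightarrow> X i \<noteq> {}"
    and Xb: "\<And>i. i \<in> J \<Longrightarrow> bounded_ideals (X i)"
    and tr: "\<And>c. (\<And>i. i \<in> J \<Longrightarrow> c i \<in> X i) \<Longrightarrow> bounded_ideals (c ` J)"
  shows "bounded_ideals (\<Union>i\<in>J. X i)"
proof (rule ccontr)
  assume ub: "\<not> bounded_ideals (\<Union>i\<in>J. X i)"
  then have "(\<Union>i\<in>J. X i) \<noteq> {}" using bounded_ideals_empty by metis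
  moreover have "(\<Union>i\<in>J. X i) \<subseteq> {I. ideal I R}" using X(1) by blast
  \<comment> \<open>Countably many ideals already make the union unbounded; only the columns they
    come from are kept.\<close>
  ultimately obtain q where q: "\<And>k :: nat. q k \<in> (\<Union>i\<in>J. X i)" "\<not> bounded_ideals (range q)"
    using transversally_bounded_sequence[OF tb, of "\<lambda>_. \<Union>i\<in>J. X i"] ub by blast
  obtain col where col: "\<And>k. col k \<in> J" "\<And>k. q k \<in> X (col k)" using q(1) unfolding UN_iff by metis
  have sub: "range q \<subseteq> (\<Union>i\<in>range col. X i)" using col(2) by blast
  have inf: "infinite (range col)"
  proof
    assume "finite (range col)"
    then have "bounded_ideals (\<Union>i\<in>range col. X i)"
      using X(1) Xb col(1) by (intro bounded_ideals_UN_finite) auto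
    then show False using bounded_ideals_subset[OF _ sub] q(2) by blast
  qed
  define e where "e = from_nat_into (range col)"
  have e: "inj e" "range e = range col"
    using bij_betw_from_nat_into[OF _ inf] unfolding e_def bij_betw_def by auto
  \<comment> \<open>Each column is also thinned to the chosen ideals, which makes the union of all
    columns countable.\<close>
  define Z where "Z n = q ` {k. col k = e n}" for n
  have ZX: "Z n \<subseteq> X (e n)" for n
  proof
    fix x assume "x \<in> Z n"
    then obtain k where "x = q k" "col k = e n" unfolding Z_def by blast
    then show "x \<in> X (e n)" using col(2)[of k] by simp
  qed
  have eJ: "e n \<in> J" for n using e(2) col(1) by (metis imageE rangeI)
  have UZ: "(\<Union>n. Z n) = range q"
  proof
    show "range q \<subseteq> (\<Union>n. Z n)"
    proof
      fix x assume "x \<in> range q"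
      then obtain k where k: "x = q k" by blast
      obtain n where "col k = e n" using e(2) by (metis imageE rangeI)
      then show "x \<in> (\<Union>n. Z n)" unfolding Z_def k by blast
    qed
  qed (auto simp: Z_def)
  interpret counterexample R Z
  proof
    show "transversally_bounded (dual_ideal_lattice R)" by (rule tb)
    show "Z i \<subseteq> {I. ideal I R}" for i using ZX X(1)[OF eJ] by blast
    show "Z i \<noteq> {}" for i
    proof -
      have "e i \<in> range col" using e(2) by blast
      then obtain k where "col k = e i" by (metis imageE)
      then show ?thesis unfolding Z_def by blast
    qed
    show "bounded_ideals (Z i)" for i using bounded_ideals_subset[OF Xb[OF eJ] ZX] .
    show "countable (\<Union>i. Z i)" unfolding UZ by simp
    show "\<not> bounded_ideals (\<Union>i. Z i)" unfolding UZ by (rule q)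
    show "bounded_ideals (range c)" if c: "\<And>i. c i \<in> Z i" for c
    proof -
      \<comment> \<open>Arbitrary choices in the dropped columns extend \<open>c\<close> to a
        transversal over \<open>J\<close>.\<close>
      define d where "d i = (if i \<in> range e then c (inv_into UNIV e i) else (SOME x. x \<in> X i))" for i
      have de: "d (e n) = c n" for n unfolding d_def using e(1) by simp
      have "d i \<in> X i" if "i \<in> J" for i
      proof (cases "i \<in> range e")
        case True
        then obtain n where n: "i = e n" by blast
        show ?thesis unfolding n de using c[of n] ZX[of n] by (rule subsetD[rotated])
      next
        case False
        then show ?thesis using X(2)[OF that] by (simp add: d_def some_in_eq)
      qed
      then have "bounded_ideals (d ` J)" by (rule tr)
      moreover have "range c \<subseteq> d ` J" using de eJ by (metis image_subset_iff imageI)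
      ultimately show ?thesis using bounded_ideals_subset by blast
    qed
  qed
  show False by (rule contradiction)
qed

section \<open>Families in the dual lattice\<close>

theorem theorem5:
  fixes R :: "('a, 'b) ring_scheme"
  assumes "domain R"
  shows "transversally_bounded (dual_ideal_lattice R) \<longleftrightarrow>
         uniformly_transversally_bounded (dual_ideal_lattice R)"
proof
  interpret domain R by (rule assms)
  let ?L = "dual_ideal_lattice R"
  show "transversally_bounded ?L" if utb: "uniformly_transversally_bounded ?L"
    unfolding transversally_bounded_def
  proof (intro allI impI)
    fix I :: "('a set set \<times> nat) set" and X
    assume ne: "nonempty_subset_family ?L I X"
      and bd: "\<forall>x\<in>transversals I X. bounded_transversal ?L I x"
    obtain J where J: "J \<subseteq> I" "finite (I - J)" "\<Squnion>\<^bsub>?L\<^esub>(\<Union>i\<in>J. X i) \<sqsubset>\<^bsub>?L\<^esub> \<top>\<^bsub>?L\<^esub>"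
      using utb ne bd unfolding uniformly_transversally_bounded_def by blast
    have "(\<Union>i\<in>J. X i) \<subseteq> carrier ?L"
      using ne J(1) unfolding nonempty_subset_family_def by blast
    then have "\<Squnion>\<^bsub>?L\<^esub>(X i) \<sqsubset>\<^bsub>?L\<^esub> \<top>\<^bsub>?L\<^esub>" if "i \<in> J" for i
      by (intro complete_lattice.sup_less_top_mono[OF complete_lattice_dual_ideal_lattice _ _ J(3)])
        (use that in blast)+
    then show "finite {i \<in> I. \<not> \<Squnion>\<^bsub>?L\<^esub>(X i) \<sqsubset>\<^bsub>?L\<^esub> \<top>\<^bsub>?L\<^esub>}"
      by (intro finite_subset[OF _ J(2)]) blast
  qed
  show "uniformly_transversally_bounded ?L" if tb: "transversally_bounded ?L"
    unfolding uniformly_transversally_bounded_def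
  proof (intro allI impI)
    fix I :: "('a set set \<times> nat) set" and X
    assume ne: "nonempty_subset_family ?L I X"
      and bd: "\<forall>x\<in>transversals I X. bounded_transversal ?L I x"
    define J where "J = {i \<in> I. \<Squnion>\<^bsub>?L\<^esub>(X i) \<sqsubset>\<^bsub>?L\<^esub> \<top>\<^bsub>?L\<^esub>}"
    have "I - J = {i \<in> I. \<not> \<Squnion>\<^bsub>?L\<^esub>(X i) \<sqsubset>\<^bsub>?L\<^esub> \<top>\<^bsub>?L\<^esub>}" unfolding J_def by blast
    then have fin: "finite (I - J)"
      using tb[unfolded transversally_bounded_def, rule_format, OF ne] bd by simp
    have X: "X i \<subseteq> {I. ideal I R}" "X i \<noteq> {}" if "i \<in> I" for i
      using ne that unfolding nonempty_subset_family_def by simp_all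
    have JI: "i \<in> I" "bounded_ideals (X i)" if "i \<in> J" for i
      using that sup_less_top_iff_bounded_ideals[OF X(1)] unfolding J_def by blast+
    have "bounded_ideals (\<Union>i\<in>J. X i)"
    proof (rule bounded_ideals_UN[OF tb])
      show "X i \<subseteq> {I. ideal I R}" "X i \<noteq> {}" "bounded_ideals (X i)" if "i \<in> J" for i
        using X JI that by blast+
      show "bounded_ideals (c ` J)" if c: "\<And>i. i \<in> J \<Longrightarrow> c i \<in> X i" for c
      proof -
        \<comment> \<open>Arbitrary choices outside \<open>J\<close> suffice: they only add ideals,
          and a subset of a bounded set is bounded.\<close>
        define d where "d = (\<lambda>i\<in>I. if i \<in> J then c i else (SOME x. x \<in> X i))"
        have d: "d i \<in> X i" if "i \<in> I" for i
          using that c X(2)[OF that] by (simp add: d_def some_in_eq)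
        then have "d \<in> transversals I X" unfolding transversals_def d_def by (auto simp: PiE_iff)
        then have "\<Squnion>\<^bsub>?L\<^esub>(d ` I) \<sqsubset>\<^bsub>?L\<^esub> \<top>\<^bsub>?L\<^esub>"
          using bd unfolding bounded_transversal_def by blast
        moreover have "d ` I \<subseteq> {I. ideal I R}" using d X(1) by blast
        ultimately have "bounded_ideals (d ` I)" using sup_less_top_iff_bounded_ideals by blast
        moreover have "c ` J \<subseteq> d ` I" using JI(1) by (auto simp: d_def image_iff)
        ultimately show ?thesis by (rule bounded_ideals_subset)
      qed
    qed
    moreover have "(\<Union>i\<in>J. X i) \<subseteq> {I. ideal I R}" using X(1) JI(1) by blast
    ultimately have "\<Squnion>\<^bsub>?L\<^esub>(\<Union>i\<in>J. X i) \<sqsubset>\<^bsub>?L\<^esub> \<top>\<^bsub>?L\<^esub>"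
      using sup_less_top_iff_bounded_ideals by blast
    then show "\<exists>J\<subseteq>I. finite (I - J) \<and> \<Squnion>\<^bsub>?L\<^esub>(\<Union>i\<in>J. X i) \<sqsubset>\<^bsub>?L\<^esub> \<top>\<^bsub>?L\<^esub>"
      using fin JI(1) by blast
  qed
qed

end
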